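(* Let $n\equiv 2\pmod 6$ with $n\geq 8$, let $C_n$ be the cycle on $n$ vertices, and let $u_1,u_2$ be distinct vertices of $C_n$ at distance $d=d(u_1,u_2)$ in $C_n$. Then $$\gamma_g^t(C_n|\{u_1,u_2\}) = \begin{cases} \gamma_g^t(C_n), & d\equiv 4 \pmod 6,\\ \gamma_g^t(C_n)-1, & d \bmod 6\in\{1,3,5\},\\ \gamma_g^t(C_n)-2, & d\bmod 6\in\{0,2\}.\end{cases}$$
   Context: The total domination game on a graph $G$ in which a set $S\subseteq V(G)$ is predominated: Dominator and Staller alternately choose vertices of $G$. A vertex $w$ is totally dominated if it lies in $S$ or if some neighbor of $w$ has already been chosen. A vertex may be chosen only if it has at least one neighbor that is not yet totally dominated. The game ends when no legal move remains. Dominator aims to minimize and Staller to maximize the number of moves. $\gamma_g^t(G|S)$ is the number of moves when Dominator starts and both play optimally; $\gamma_g^t(G)=\gamma_g^t(G|\emptyset)$. *)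

theory Defs
  imports Main
begin

text \<open>A simple graph is a pair of a vertex set and a set of two-element edges.\<close>

type_synonym 'a graph = "'a set \<times> 'a set set"

abbreviation verts :: "'a graph \<Rightarrow> 'a set" where
  "verts G \<equiv> fst G"

abbreviation edges :: "'a graph \<Rightarrow> 'a set set" where
  "edges G \<equiv> snd G"

definition neighbors :: "'a graph \<Rightarrow> 'a \<Rightarrow> 'a set" where
  "neighbors G v = {w \<in> verts G. {v, w} \<in> edges G}"

definition is_walk :: "'a graph \<Rightarrow> 'a list \<Rightarrow> bool" where
  "is_walk G p \<longleftrightarrow> p \<noteq> [] \<and> set p \<subseteq> verts G \<and>
     (\<forall>i. Suc i < length p \<longrightarrow> {p ! i, p ! Suc i} \<in> edges G)"

text \<open>Only meaningful if \<open>u\<close> and \<open>v\<close> lie in the same component.\<close>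

definition graph_dist :: "'a graph \<Rightarrow> 'a \<Rightarrow> 'a \<Rightarrow> nat" where
  "graph_dist G u v =
     (LEAST k. \<exists>p. is_walk G p \<and> hd p = u \<and> last p = v \<and> length p = Suc k)"

text \<open>This is the cycle only for \<open>n \<ge> 3\<close>.\<close>

definition cycle_graph :: "nat \<Rightarrow> nat graph" where
  "cycle_graph n = ({0..<n}, {{i, Suc i mod n} | i. i < n})"

definition totally_dominated :: "'a graph \<Rightarrow> 'a set \<Rightarrow> 'a set \<Rightarrow> 'a set" where
  "totally_dominated G S C = {w \<in> verts G. w \<in> S \<or> neighbors G w \<inter> C \<noteq> {}}"

definition legal_moves :: "'a graph \<Rightarrow> 'a set \<Rightarrow> 'a set \<Rightarrow> 'a set" where
  "legal_moves G S C =
     {v \<in> verts G. \<exists>w \<in> neighbors G v. w \<notin> totally_dominated G S C}"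

lemma legal_moves_not_chosen: "v \<in> legal_moves G S C \<Longrightarrow> v \<notin> C"
  unfolding legal_moves_def totally_dominated_def neighbors_def
  by (force simp: insert_commute)

lemma card_remaining_less:
  assumes "finite (verts G)" and "v \<in> legal_moves G S C"
  shows "card (verts G - insert v C) < card (verts G - C)"
proof (rule psubset_card_mono)
  have "v \<in> verts G - C"
    using assms(2) legal_moves_not_chosen[OF assms(2)] by (simp add: legal_moves_def)
  then show "verts G - insert v C \<subset> verts G - C"
    by blast
qed (use assms(1) in simp)

datatype player = Dominator | Staller

text \<open>
  \<open>game_moves G S P C\<close> is the number of moves still to be played under optimal play when
  \<open>S\<close> is predominated, \<open>C\<close> is the set of vertices chosen so far and \<open>P\<close> is to move.
  The value on infinite graphs is a dummy that makes the recursion total.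
\<close>

function game_moves :: "'a graph \<Rightarrow> 'a set \<Rightarrow> player \<Rightarrow> 'a set \<Rightarrow> nat" where
  "game_moves G S P C =
     (if infinite (verts G) \<or> legal_moves G S C = {} then 0
      else case P of
        Dominator \<Rightarrow> Min ((\<lambda>v. 1 + game_moves G S Staller (insert v C)) ` legal_moves G S C)
      | Staller \<Rightarrow> Max ((\<lambda>v. 1 + game_moves G S Dominator (insert v C)) ` legal_moves G S C))"
  by pat_completeness auto
termination
  by (relation "measure (\<lambda>(G, S, P, C). card (verts G - C))")
    (simp_all add: card_remaining_less)

declare game_moves.simps [simp del]

definition total_dom_game_number :: "'a graph \<Rightarrow> 'a set \<Rightarrow> nat" where
  "total_dom_game_number G S = game_moves G S Dominator {}"

end

theory Submission
  imports Defs
begin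

text \<open>
  In an even cycle the neighbourhood of a vertex consists of two vertices that are two steps
  apart, so the game is played on the two orbits of \<open>x \<mapsto> x + 2\<close>: a move dominates two
  consecutive vertices of an orbit. Once an orbit contains a dominated vertex, its undominated
  vertices form gaps, and a gap of length \<open>r\<close> gets the weight \<open>r + \<lceil>r/3\<rceil>\<close>. Every move in such an
  orbit lowers the total weight \<open>W\<close> by 1, 2 or 3; some move lowers it by at least 2 and some by
  at most 2, and for odd \<open>W\<close> moves lowering it by exactly 1 and by exactly 3 exist. Induction
  then gives the values \<open>\<lfloor>W/2\<rfloor>\<close> (Dominator to move) and \<open>\<lceil>W/2\<rceil>\<close> (Staller to move) if no orbit is
  untouched, and \<open>2k + 1 + 2\<lfloor>W/4\<rfloor>\<close> and \<open>2k + 2\<lceil>W/4\<rceil>\<close> if one orbit of length \<open>3k + 1\<close> is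
  untouched. For \<open>n = 6k + 2\<close> both orbits have length \<open>3k + 1\<close>.
\<close>

section \<open>Arithmetic of gap weights\<close>

definition gap_weight :: "nat \<Rightarrow> nat" where
  "gap_weight r = r + (r + 2) div 3"

lemma gap_weight_0 [simp]: "gap_weight 0 = 0"
  by (simp add: gap_weight_def)

lemma gap_weight_residues:
  "gap_weight (3 * a) = 4 * a" "gap_weight (3 * a + 1) = 4 * a + 2" "gap_weight (3 * a + 2) = 4 * a + 3"
  unfolding gap_weight_def by presburger+

lemma gap_weight_shorten:
  "gap_weight r + 1 \<le> gap_weight (Suc r)" "gap_weight (Suc r) \<le> gap_weight r + 2"
  unfolding gap_weight_def by presburger+

text \<open>A move inside a gap dominates two adjacent vertices of it and leaves gaps of lengths
  \<open>i\<close> and \<open>j\<close>; the total weight then drops by 2 or 3. The preceding lemma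
  is the counterpart for a move that removes one end vertex of a gap, where the drop is 1 or
  2.\<close>

lemma gap_weight_split:
  "gap_weight i + gap_weight j + 2 \<le> gap_weight (i + j + 2)"
  "gap_weight (i + j + 2) \<le> gap_weight i + gap_weight j + 3"
  unfolding gap_weight_def by presburger+

text \<open>The weight is odd exactly for \<open>r mod 3 = 2\<close>. Such a gap offers both extreme
  drops: 1 by removing one vertex, 3 by removing two.\<close>

lemma odd_gap_weightE:
  assumes "odd (gap_weight r)"
  obtains s where "r = Suc (Suc s)" "gap_weight r = gap_weight (Suc s) + 1"
    "gap_weight r = gap_weight s + 3"
proof -
  have "r mod 3 = 2"
    using assms unfolding gap_weight_def by presburger
  then obtain a where a: "r = Suc (Suc (3 * a))"
    by (metis add_2_eq_Suc add.commute mult_div_mod_eq)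
  show ?thesis
    by (rule that[OF a]) (simp_all add: a gap_weight_def)
qed

text \<open>Every nonempty gap allows a drop of at least 2: a gap of length 1 is filled, and a
  longer one loses two vertices at its end.\<close>

lemma gap_weight_reduce_by_two:
  obtains "gap_weight (Suc r) = gap_weight r + 2"
  | s where "r = Suc s" "gap_weight s + 2 \<le> gap_weight (Suc r)"
proof (cases r)
  case 0
  then show ?thesis using that(1) by (simp add: gap_weight_def)
next
  case (Suc s)
  then show ?thesis using that(2) gap_weight_split(1)[of 0 s] by simp
qed

text \<open>Used for Dominator when one orbit is untouched. The bound gives
  \<open>w' + 3 \<le> w + 1 - w mod 2\<close>, and the largest even number not above
  \<open>w\<close> is at most \<open>4 * (w div 4) + 2\<close>. The next lemma is the dual estimate
  for Staller.\<close>

lemma div_4_le_of_even_bound: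
  fixes w w' :: nat
  assumes "w' + 2 + w mod 2 \<le> w"
  shows "(w' + 3) div 4 \<le> w div 4"
proof -
  have "w + 1 - w mod 2 \<le> 4 * (w div 4) + 3" by presburger
  then have "w' + 3 \<le> 4 * (w div 4) + 3" using assms by linarith
  then show ?thesis by linarith
qed

lemma ceiling_div_4_le_of_even_bound:
  fixes w w' :: nat
  assumes "w + w mod 2 \<le> w' + 2"
  shows "(w + 3) div 4 \<le> w' div 4 + 1"
proof -
  have "4 * ((w + 3) div 4) \<le> w + w mod 2 + 2" by presburger
  then have "4 * ((w + 3) div 4) \<le> w' + 4" using assms by linarith
  then show ?thesis by linarith
qed

section \<open>The game recursion on finite graphs\<close>

lemma totally_dominated_insert:
  assumes "v \<in> verts G"
  shows "totally_dominated G S (insert v C) = totally_dominated G S C \<union> neighbors G v"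
  using assms unfolding totally_dominated_def neighbors_def by (auto simp: insert_commute)

lemma legal_moves_iff:
  "v \<in> legal_moves G S C \<longleftrightarrow> v \<in> verts G \<and> \<not> neighbors G v \<subseteq> totally_dominated G S C"
  unfolding legal_moves_def by auto

lemma finite_legal_moves: "finite (verts G) \<Longrightarrow> finite (legal_moves G S C)"
  unfolding legal_moves_def by simp

lemma game_moves_no_legal: "legal_moves G S C = {} \<Longrightarrow> game_moves G S P C = 0"
  by (subst game_moves.simps) simp

text \<open>A bound valid for all moves together with one move attaining it determines the minimum,
  so strategies can be given by a single witness.\<close>

lemma game_moves_DominatorI:
  assumes "finite (verts G)"
    and "\<And>v. v \<in> legal_moves G S C \<Longrightarrow> m \<le> Suc (game_moves G S Staller (insert v C))"
    and "v \<in> legal_moves G S C" "Suc (game_moves G S Staller (insert v C)) \<le> m"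
  shows "game_moves G S Dominator C = m"
proof -
  have "Min ((\<lambda>v. 1 + game_moves G S Staller (insert v C)) ` legal_moves G S C) = m"
  proof (rule Min_eqI)
    show "m \<in> (\<lambda>v. 1 + game_moves G S Staller (insert v C)) ` legal_moves G S C"
      using assms(2)[OF assms(3)] assms(3,4) by (intro image_eqI[of _ _ v]) simp_all
  qed (use assms(2) finite_legal_moves[OF assms(1)] in auto)
  with assms(1,3) show ?thesis
    by (subst game_moves.simps) auto
qed

lemma game_moves_StallerI:
  assumes "finite (verts G)"
    and "\<And>v. v \<in> legal_moves G S C \<Longrightarrow> Suc (game_moves G S Dominator (insert v C)) \<le> m"
    and "v \<in> legal_moves G S C" "m \<le> Suc (game_moves G S Dominator (insert v C))"
  shows "game_moves G S Staller C = m"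
proof -
  have "Max ((\<lambda>v. 1 + game_moves G S Dominator (insert v C)) ` legal_moves G S C) = m"
  proof (rule Max_eqI)
    show "m \<in> (\<lambda>v. 1 + game_moves G S Dominator (insert v C)) ` legal_moves G S C"
      using assms(2)[OF assms(3)] assms(3,4) by (intro image_eqI[of _ _ v]) simp_all
  qed (use assms(2) finite_legal_moves[OF assms(1)] in auto)
  with assms(1,3) show ?thesis
    by (subst game_moves.simps) auto
qed

text \<open>A move matters only through the neighborhood it dominates, so it suffices to know the
  family of all neighborhoods. Which vertex has which pair as its neighborhood is left open. For a
  cycle, \<open>\<sigma>\<close> is the step by 2.\<close>

locale perm_graph =
  fixes G :: "'a graph" and \<sigma> :: "'a \<Rightarrow> 'a"
  assumes finite_verts: "finite (verts G)"
    and bij_\<sigma>: "bij_betw \<sigma> (verts G) (verts G)"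
    and neighborhoods: "neighbors G ` verts G = (\<lambda>x. {x, \<sigma> x}) ` verts G"
begin

abbreviation V :: "'a set" where "V \<equiv> verts G"

text \<open>The search starts one step after \<open>p\<close>. Hence, if \<open>p\<close> is the
  only element of \<open>D\<close> in its orbit, the gap runs all the way round to \<open>p\<close>
  itself.\<close>

definition gap :: "'a set \<Rightarrow> 'a \<Rightarrow> nat" where
  "gap D p = (LEAST r. (\<sigma> ^^ Suc r) p \<in> D)"

definition weight :: "'a set \<Rightarrow> nat" where
  "weight D = (\<Sum>p\<in>D. gap_weight (gap D p))"

text \<open>For \<open>D \<subseteq> V\<close> this is the union of the orbits that meet
  \<open>D\<close>: on a finite set the forward iterates of a permutation already sweep out whole
  orbits.\<close>

definition covered :: "'a set \<Rightarrow> 'a set" where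
  "covered D = {(\<sigma> ^^ t) y | t y. y \<in> D}"

lemma weight_empty [simp]: "weight {} = 0"
  by (simp add: weight_def)

lemma covered_empty [simp]: "covered {} = {}"
  by (simp add: covered_def)

section \<open>Iterates of the permutation and the gaps they cut out\<close>

lemma step_in: "x \<in> V \<Longrightarrow> \<sigma> x \<in> V"
  using bij_\<sigma> by (auto simp: bij_betw_def)

lemma iter_in: "x \<in> V \<Longrightarrow> (\<sigma> ^^ i) x \<in> V"
  by (induction i) (auto simp: step_in)

lemma inj_on_iter: "inj_on (\<sigma> ^^ i) V"
proof (induction i)
  case (Suc i)
  show ?case
  proof (rule inj_onI)
    fix x y assume *: "x \<in> V" "y \<in> V" "(\<sigma> ^^ Suc i) x = (\<sigma> ^^ Suc i) y"
    then have "(\<sigma> ^^ i) x = (\<sigma> ^^ i) y"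
      using bij_\<sigma> iter_in by (auto simp: bij_betw_def dest: inj_onD)
    with Suc * show "x = y" by (auto dest: inj_onD)
  qed
qed simp

lemma iter_diff:
  assumes "x \<in> V" "y \<in> V" "(\<sigma> ^^ i) x = (\<sigma> ^^ j) y" "i \<le> j"
  shows "x = (\<sigma> ^^ (j - i)) y"
proof -
  have "(\<sigma> ^^ j) y = (\<sigma> ^^ i) ((\<sigma> ^^ (j - i)) y)"
    using assms(4) by (metis comp_apply funpow_add le_add_diff_inverse)
  with assms show ?thesis
    using inj_onD[OF inj_on_iter[of i]] iter_in by metis
qed

text \<open>By finiteness two iterates of \<open>x\<close> coincide, and cancelling the common part
  brings \<open>x\<close> back to itself.\<close>

lemma iter_returns:
  assumes "x \<in> V"
  obtains r where "(\<sigma> ^^ Suc r) x = x"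
proof -
  have "\<not> inj (\<lambda>i. (\<sigma> ^^ i) x)"
  proof
    assume "inj (\<lambda>i. (\<sigma> ^^ i) x)"
    moreover have "range (\<lambda>i. (\<sigma> ^^ i) x) \<subseteq> V"
      using iter_in[OF assms] by auto
    ultimately show False
      using finite_verts finite_imageD finite_subset infinite_UNIV_nat by blast
  qed
  then obtain i j where "i < j" "(\<sigma> ^^ i) x = (\<sigma> ^^ j) x"
    by (metis (mono_tags, lifting) injI linorder_neqE_nat)
  then have "x = (\<sigma> ^^ (j - i)) x" "j - i = Suc (j - i - 1)"
    using iter_diff[OF assms assms] by auto
  then show ?thesis using that by metis
qed

lemma gap_end:
  assumes "D \<subseteq> V" "p \<in> D"
  shows "(\<sigma> ^^ Suc (gap D p)) p \<in> D"
proof -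
  obtain r where "(\<sigma> ^^ Suc r) p = p"
    using iter_returns assms by blast
  then have "(\<sigma> ^^ Suc r) p \<in> D" using assms by simp
  then show ?thesis unfolding gap_def by (rule LeastI)
qed

lemma gap_interior: "i < gap D p \<Longrightarrow> (\<sigma> ^^ Suc i) p \<notin> D"
  unfolding gap_def by (rule not_less_Least)

lemma gap_eqI:
  assumes "(\<sigma> ^^ Suc r) p \<in> D" "\<And>i. i < r \<Longrightarrow> (\<sigma> ^^ Suc i) p \<notin> D"
  shows "gap D p = r"
  unfolding gap_def using assms by (metis (no_types, lifting) Least_equality not_le)

text \<open>Among all ways to reach \<open>x\<close> from \<open>D\<close> the shortest one is
  taken. By minimality it meets no element of \<open>D\<close> after its start, so \<open>x\<close>
  lies in the gap behind that start.\<close>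

lemma coveredE:
  assumes "x \<in> covered D" "D \<subseteq> V" "x \<notin> D"
  obtains p i where "p \<in> D" "i < gap D p" "x = (\<sigma> ^^ Suc i) p"
proof -
  let ?P = "\<lambda>t. \<exists>y\<in>D. x = (\<sigma> ^^ t) y"
  define t where "t = (LEAST t. ?P t)"
  have "\<exists>t. ?P t" using assms(1) by (auto simp: covered_def)
  then have "?P t" unfolding t_def by (rule LeastI_ex)
  then obtain y where y: "y \<in> D" "x = (\<sigma> ^^ t) y" by blast
  then obtain i where t: "t = Suc i" using assms(3) by (cases t) auto
  have "(\<sigma> ^^ s) y \<notin> D" if "0 < s" "s \<le> t" for s
  proof
    assume "(\<sigma> ^^ s) y \<in> D"
    moreover have "x = (\<sigma> ^^ (t - s)) ((\<sigma> ^^ s) y)"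
      using that y(2) by (metis comp_apply funpow_add le_add_diff_inverse2)
    ultimately have "t \<le> t - s" unfolding t_def by (intro Least_le) blast
    with that show False by simp
  qed
  then have "\<not> gap D y \<le> i"
    using gap_end[OF assms(2) y(1)] t by (metis Suc_le_mono zero_less_Suc)
  with that[of y i] y t show ?thesis by simp
qed

text \<open>Different gaps are disjoint. Cancelling the smaller offset makes one starting point an
  iterate of the other; a nonzero offset would place an element of \<open>D\<close> inside a
  gap.\<close>

lemma gap_position_unique:
  assumes "D \<subseteq> V" "p \<in> D" "q \<in> D" "i < gap D p" "j < gap D q" "(\<sigma> ^^ Suc i) p = (\<sigma> ^^ Suc j) q"
  shows "p = q"
proof -
  have *: "p = q" if "p \<in> D" "q \<in> D" "i \<le> j" "j < gap D q" "(\<sigma> ^^ Suc i) p = (\<sigma> ^^ Suc j) q"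
    for p q i j
  proof -
    have "p = (\<sigma> ^^ (j - i)) q"
      using iter_diff[of p q "Suc i" "Suc j"] that assms(1) by auto
    then show ?thesis
      using gap_interior[of "j - i - 1" D q] that by (cases "j - i") auto
  qed
  show ?thesis
    using *[of p q i j] *[of q p j i] assms by (metis nat_le_linear)
qed

text \<open>Only the gap containing \<open>q\<close> changes: it is cut into one of length
  \<open>i\<close> before \<open>q\<close> and the remainder behind \<open>q\<close>. The weight
  identity is additive to avoid truncated subtraction.\<close>

lemma weight_insert:
  assumes "D \<subseteq> V" "p \<in> D" "i < gap D p" and q: "q = (\<sigma> ^^ Suc i) p"
  shows "gap (insert q D) q = gap D p - Suc i"
    and "weight (insert q D) + gap_weight (gap D p) =
      weight D + gap_weight i + gap_weight (gap D p - Suc i)"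
proof -
  let ?D = "insert q D"
  have qD: "q \<notin> D" using gap_interior assms by blast
  have finD: "finite D" using assms finite_verts finite_subset by blast
  have shift: "(\<sigma> ^^ j) q = (\<sigma> ^^ (Suc i + j)) p" for j
    unfolding q by (metis add.commute comp_apply funpow_add)
  have q_not: "(\<sigma> ^^ Suc j) p' \<noteq> q" if "p' \<in> D" "j < gap D p'" "p' \<noteq> p" for p' j
    using gap_position_unique[OF assms(1) _ assms(2) _ assms(3)] that q by metis
  show gq: "gap ?D q = gap D p - Suc i"
  proof (rule gap_eqI)
    have "Suc i + Suc (gap D p - Suc i) = Suc (gap D p)" using assms(3) by simp
    then show "(\<sigma> ^^ Suc (gap D p - Suc i)) q \<in> ?D"
      unfolding shift using gap_end[OF assms(1,2)] by simp
  next
    fix j assume j: "j < gap D p - Suc i"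
    have "(\<sigma> ^^ Suc j) q \<notin> D"
      unfolding shift using gap_interior[of "Suc (i + j)" D p] j by simp
    \<comment> \<open>A return of \<open>q\<close> to itself this early would, after cancelling the
      way from \<open>p\<close> to \<open>q\<close>, make \<open>p\<close> return inside its own
      gap.\<close>
    moreover have "(\<sigma> ^^ Suc j) q \<noteq> q"
    proof
      assume "(\<sigma> ^^ Suc j) q = q"
      then have "p = (\<sigma> ^^ (Suc i + Suc j - Suc i)) p"
        using iter_diff[of p p "Suc i" "Suc i + Suc j"] assms(1,2) q shift[of "Suc j"] by auto
      then show False
        using gap_interior[of j D p] j assms(2) by (metis add_diff_cancel_left' diff_le_self order_less_le_trans)
    qed
    ultimately show "(\<sigma> ^^ Suc j) q \<notin> ?D" by simp
  qed
  have gp: "gap ?D p = i"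
  proof (rule gap_eqI)
    show "(\<sigma> ^^ Suc i) p \<in> ?D" using q by simp
  next
    fix j assume j: "j < i"
    have "(\<sigma> ^^ Suc j) p \<noteq> q"
    proof
      assume "(\<sigma> ^^ Suc j) p = q"
      then have "p = (\<sigma> ^^ (i - j)) p"
        using iter_diff[of p p "Suc j" "Suc i"] assms(1,2) q j by auto
      moreover have "i - Suc j < gap D p" using j assms(3) by simp
      ultimately show False
        using gap_interior[of "i - Suc j" D p] j assms(2) by (simp del: funpow.simps add: Suc_diff_Suc)
    qed
    then show "(\<sigma> ^^ Suc j) p \<notin> ?D"
      using gap_interior[of j D p] j assms(3) by simp
  qed
  have other: "gap ?D p' = gap D p'" if "p' \<in> D - {p}" for p'
  proof (rule gap_eqI)
    show "(\<sigma> ^^ Suc (gap D p')) p' \<in> ?D" using gap_end[OF assms(1)] that by blast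
  next
    fix j assume "j < gap D p'"
    then show "(\<sigma> ^^ Suc j) p' \<notin> ?D"
      using gap_interior q_not that by blast
  qed
  have "weight ?D = gap_weight (gap ?D q) + (\<Sum>p'\<in>D. gap_weight (gap ?D p'))"
    unfolding weight_def using finD qD by simp
  also have "(\<Sum>p'\<in>D. gap_weight (gap ?D p')) =
      gap_weight i + (\<Sum>p'\<in>D - {p}. gap_weight (gap ?D p'))"
    using sum.remove[OF finD assms(2), of "\<lambda>p'. gap_weight (gap ?D p')"] gp by simp
  also have "(\<Sum>p'\<in>D - {p}. gap_weight (gap ?D p')) = (\<Sum>p'\<in>D - {p}. gap_weight (gap D p'))"
    using other by (intro sum.cong) auto
  finally show "weight ?D + gap_weight (gap D p) =
      weight D + gap_weight i + gap_weight (gap D p - Suc i)"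
    unfolding weight_def using sum.remove[OF finD assms(2), of "\<lambda>p. gap_weight (gap D p)"] gq by simp
qed

section \<open>Effect of a move on the weight\<close>

lemma weight_shorten:
  assumes "D \<subseteq> V" "p \<in> D" "gap D p = Suc r"
  shows "weight (insert (\<sigma> p) D) + gap_weight (Suc r) = weight D + gap_weight r"
  using weight_insert(2)[OF assms(1,2), of 0 "\<sigma> p"] assms(3) by simp

text \<open>The two vertices are inserted one after the other: \<open>x\<close> cuts the gap into
  lengths \<open>i\<close> and \<open>Suc j\<close>, and \<open>\<sigma> x\<close> then shortens the
  second piece to \<open>j\<close>.\<close>

lemma weight_split:
  assumes "D \<subseteq> V" "p \<in> D" "gap D p = i + j + 2" and x: "x = (\<sigma> ^^ Suc i) p"
  shows "weight (D \<union> {x, \<sigma> x}) + gap_weight (i + j + 2) = weight D + gap_weight i + gap_weight j"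
proof -
  have i: "i < gap D p" using assms by simp
  note ins = weight_insert[OF assms(1,2) i x]
  have "x \<in> V" using x assms iter_in by blast
  then have "insert x D \<subseteq> V" using assms by simp
  moreover have "gap (insert x D) x = Suc j" using ins(1) assms(3) by simp
  ultimately have "weight (insert (\<sigma> x) (insert x D)) + gap_weight (Suc j) =
      weight (insert x D) + gap_weight j"
    by (intro weight_shorten) auto
  moreover have "insert (\<sigma> x) (insert x D) = D \<union> {x, \<sigma> x}" by blast
  ultimately show ?thesis using ins(2) assms(3) by simp
qed

text \<open>A pair in a touched orbit removes the first vertex of a gap (\<open>x \<in> D\<close>),
  the last vertex of a gap (\<open>\<sigma> x \<in> D\<close>), or two vertices of one gap. The
  first two kinds lower the weight by 1 or 2, the third by 2 or 3.\<close>

lemma weight_move_bounds: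
  assumes "D \<subseteq> V" "x \<in> covered D" "\<not> {x, \<sigma> x} \<subseteq> D"
  shows "weight (D \<union> {x, \<sigma> x}) + 1 \<le> weight D \<and> weight D \<le> weight (D \<union> {x, \<sigma> x}) + 3"
proof (cases "x \<in> D")
  case True
  then have "\<sigma> x \<notin> D" using assms by blast
  then have "gap D x \<noteq> 0" using gap_end[OF assms(1) True] by (metis funpow_0 funpow.simps(2) comp_apply)
  then obtain r where r: "gap D x = Suc r" using not0_implies_Suc by blast
  have "D \<union> {x, \<sigma> x} = insert (\<sigma> x) D" using True by blast
  then show ?thesis
    using weight_shorten[OF assms(1) True r] gap_weight_shorten[of r] by simp
next
  case False
  then obtain p i where p: "p \<in> D" "i < gap D p" "x = (\<sigma> ^^ Suc i) p"
    using coveredE assms by blast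
  show ?thesis
  proof (cases "gap D p = Suc i")
    case True
    then have "\<sigma> x \<in> D" using gap_end[OF assms(1) p(1)] p(3) by simp
    then have "D \<union> {x, \<sigma> x} = insert x D" by blast
    then show ?thesis
      using weight_insert(2)[OF assms(1) p] True gap_weight_shorten[of i] by simp
  next
    case False
    then obtain j where j: "gap D p = i + j + 2"
      using p(2) by (metis add_Suc_right add_2_eq_Suc' less_iff_Suc_add not0_implies_Suc add.right_neutral)
    show ?thesis
      using weight_split[OF assms(1) p(1) j p(3)] gap_weight_split[of i j] by linarith
  qed
qed

lemma covered_move:
  assumes "x \<in> covered D"
  shows "covered (D \<union> {x, \<sigma> x}) = covered D"
proof -
  obtain t y where y: "y \<in> D" "x = (\<sigma> ^^ t) y" using assms by (auto simp: covered_def)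
  have "(\<sigma> ^^ s) x = (\<sigma> ^^ (s + t)) y" "(\<sigma> ^^ s) (\<sigma> x) = (\<sigma> ^^ (s + Suc t)) y" for s
    unfolding y(2) by (simp_all add: funpow_add funpow_swap1)
  then show ?thesis using y(1) unfolding covered_def by blast
qed

lemma subset_covered: "D \<subseteq> covered D"
  unfolding covered_def by (force intro: exI[of _ 0])

lemma iter_covered: "p \<in> D \<Longrightarrow> (\<sigma> ^^ i) p \<in> covered D"
  unfolding covered_def by blast

text \<open>An odd sum has an odd summand, so some gap has odd weight. Behind its start
  \<open>p\<close>, the pair at \<open>p\<close> removes one vertex and the pair at
  \<open>\<sigma> p\<close> removes two, with drops 1 and 3.\<close>

lemma weight_move_odd:
  assumes "D \<subseteq> V" "odd (weight D)"
  obtains x y where "x \<in> covered D \<inter> V" "\<not> {x, \<sigma> x} \<subseteq> D" "weight D = weight (D \<union> {x, \<sigma> x}) + 1"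
    "y \<in> covered D \<inter> V" "\<not> {y, \<sigma> y} \<subseteq> D" "weight D = weight (D \<union> {y, \<sigma> y}) + 3"
proof -
  obtain p where p: "p \<in> D" "odd (gap_weight (gap D p))"
    using assms(2) unfolding weight_def by (metis dvd_sum)
  then obtain s where s: "gap D p = Suc (Suc s)" "gap_weight (gap D p) = gap_weight (Suc s) + 1"
    "gap_weight (gap D p) = gap_weight s + 3"
    using odd_gap_weightE by blast
  have out: "\<sigma> p \<notin> D" using gap_interior[of 0 D p] s(1) by simp
  have mem: "p \<in> covered D \<inter> V" "\<sigma> p \<in> covered D \<inter> V"
    using p assms iter_covered[of p D 1] subset_covered step_in by auto
  have "D \<union> {p, \<sigma> p} = insert (\<sigma> p) D" using p by blast
  then have "weight D = weight (D \<union> {p, \<sigma> p}) + 1"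
    using weight_shorten[OF assms(1) p(1) s(1)] s by simp
  moreover have "weight D = weight (D \<union> {\<sigma> p, \<sigma> (\<sigma> p)}) + 3"
    using weight_split[OF assms(1) p(1), of 0 s "\<sigma> p"] s by simp
  ultimately show ?thesis using that[of p "\<sigma> p"] mem out by blast
qed

text \<open>An undominated vertex in a touched orbit yields a nonempty gap. Removing its first
  vertex costs at most 2; removing its first one or two vertices, depending on its length, costs at
  least 2. The two moves may coincide.\<close>

lemma weight_move_exists:
  assumes "D \<subseteq> V" "z \<in> covered D" "z \<notin> D"
  obtains x y where "x \<in> covered D \<inter> V" "\<not> {x, \<sigma> x} \<subseteq> D" "weight D \<le> weight (D \<union> {x, \<sigma> x}) + 2"
    "y \<in> covered D \<inter> V" "\<not> {y, \<sigma> y} \<subseteq> D" "weight (D \<union> {y, \<sigma> y}) + 2 \<le> weight D"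
proof -
  obtain p i where p: "p \<in> D" "i < gap D p" using coveredE[OF assms(2,1,3)] by blast
  then obtain r where r: "gap D p = Suc r" using less_imp_Suc_add by blast
  have out: "\<sigma> p \<notin> D" using gap_interior[of 0 D p] r by simp
  have mem: "p \<in> covered D \<inter> V" "\<sigma> p \<in> covered D \<inter> V"
    using p assms iter_covered[of p D 1] subset_covered step_in by auto
  have eq: "D \<union> {p, \<sigma> p} = insert (\<sigma> p) D" using p by blast
  have short: "weight (D \<union> {p, \<sigma> p}) + gap_weight (Suc r) = weight D + gap_weight r"
    unfolding eq by (rule weight_shorten[OF assms(1) p(1) r])
  then have le: "weight D \<le> weight (D \<union> {p, \<sigma> p}) + 2"
    using gap_weight_shorten[of r] by simp
  show ?thesis
  proof (cases r rule: gap_weight_reduce_by_two)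
    case 1
    then show ?thesis using that[of p p] mem out le short by simp
  next
    case (2 s)
    have "weight (D \<union> {\<sigma> p, \<sigma> (\<sigma> p)}) + 2 \<le> weight D"
      using weight_split[OF assms(1) p(1), of 0 s "\<sigma> p"] r 2 by simp
    then show ?thesis using that[of p "\<sigma> p"] mem out le by blast
  qed
qed

text \<open>The good move for Dominator: a drop of at least 2, and of 3 when the weight is odd. The
  term \<open>weight D mod 2\<close> merges both parities.\<close>

lemma weight_move_large:
  assumes "D \<subseteq> V" "z \<in> covered D" "z \<notin> D"
  obtains y where "y \<in> covered D" "y \<in> V" "\<not> {y, \<sigma> y} \<subseteq> D"
    "weight (D \<union> {y, \<sigma> y}) + 2 + weight D mod 2 \<le> weight D"
proof (cases "even (weight D)")
  case True
  then show ?thesis using weight_move_exists[OF assms] that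
    by (metis Int_iff add.right_neutral even_iff_mod_2_eq_zero)
next
  case False
  obtain y where "y \<in> covered D \<inter> V" "\<not> {y, \<sigma> y} \<subseteq> D" "weight D = weight (D \<union> {y, \<sigma> y}) + 3"
    using weight_move_odd[OF assms(1) False] by metis
  with False show ?thesis using that[of y] by (simp add: odd_iff_mod_2_eq_one)
qed

text \<open>The good move for Staller: a drop of at most 2, and of 1 when the weight is odd.\<close>

lemma weight_move_small:
  assumes "D \<subseteq> V" "z \<in> covered D" "z \<notin> D"
  obtains y where "y \<in> covered D" "y \<in> V" "\<not> {y, \<sigma> y} \<subseteq> D"
    "weight D + weight D mod 2 \<le> weight (D \<union> {y, \<sigma> y}) + 2"
proof (cases "even (weight D)")
  case True
  then show ?thesis using weight_move_exists[OF assms] that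
    by (metis Int_iff add.right_neutral even_iff_mod_2_eq_zero)
next
  case False
  obtain y where "y \<in> covered D \<inter> V" "\<not> {y, \<sigma> y} \<subseteq> D" "weight D = weight (D \<union> {y, \<sigma> y}) + 1"
    using weight_move_odd[OF assms(1) False] by metis
  with False show ?thesis using that[of y] by (simp add: odd_iff_mod_2_eq_one)
qed

lemma weight_verts: "weight V = 0"
proof -
  have "gap V p = 0" if "p \<in> V" for p
    using that by (intro gap_eqI) (auto simp: step_in)
  then show ?thesis unfolding weight_def by simp
qed

section \<open>Game values in terms of dominated pairs\<close>

lemma neighborhoodE:
  assumes "v \<in> V"
  obtains x where "x \<in> V" "neighbors G v = {x, \<sigma> x}"
  using imageI[OF assms, of "neighbors G"] unfolding neighborhoods by auto

lemma neighborhood_ofE: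
  assumes "x \<in> V"
  obtains v where "v \<in> V" "neighbors G v = {x, \<sigma> x}"
  using imageI[OF assms, of "\<lambda>x. {x, \<sigma> x}"] unfolding neighborhoods[symmetric] by auto

text \<open>Moves are replaced by the pairs they dominate. The value \<open>f x\<close> is required
  for every \<open>C'\<close> with the given dominated set, because different vertices may dominate
  the same pair.\<close>

lemma game_value_Dominator:
  assumes "totally_dominated G S C = D"
    and f: "\<And>x C'. x \<in> V \<Longrightarrow> \<not> {x, \<sigma> x} \<subseteq> D \<Longrightarrow> totally_dominated G S C' = D \<union> {x, \<sigma> x} \<Longrightarrow>
      game_moves G S Staller C' = f x"
    and lower: "\<And>x. x \<in> V \<Longrightarrow> \<not> {x, \<sigma> x} \<subseteq> D \<Longrightarrow> m \<le> Suc (f x)"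
    and upper: "y \<in> V" "\<not> {y, \<sigma> y} \<subseteq> D" "Suc (f y) \<le> m"
  shows "game_moves G S Dominator C = m"
proof -
  have val: "game_moves G S Staller (insert v C) = f x"
    if "v \<in> V" "x \<in> V" "neighbors G v = {x, \<sigma> x}" "\<not> {x, \<sigma> x} \<subseteq> D" for v x
    using that assms(1) by (intro f) (auto simp: totally_dominated_insert)
  obtain v where v: "v \<in> V" "neighbors G v = {y, \<sigma> y}"
    using neighborhood_ofE[OF upper(1)] by blast
  show ?thesis
  proof (rule game_moves_DominatorI[OF finite_verts])
    fix w assume "w \<in> legal_moves G S C"
    then have w: "w \<in> V" "\<not> neighbors G w \<subseteq> D"
      using assms(1) by (simp_all add: legal_moves_iff)
    obtain x where x: "x \<in> V" "neighbors G w = {x, \<sigma> x}"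
      using neighborhoodE[OF w(1)] .
    then have "\<not> {x, \<sigma> x} \<subseteq> D" using w(2) by simp
    then show "m \<le> Suc (game_moves G S Staller (insert w C))"
      using val[OF w(1) x] lower[OF x(1)] by simp
  next
    show "v \<in> legal_moves G S C" using v upper(2) assms(1) by (simp add: legal_moves_iff)
    show "Suc (game_moves G S Staller (insert v C)) \<le> m" using val[OF v(1) upper(1) v(2) upper(2)] upper(3) by simp
  qed
qed

lemma game_value_Staller:
  assumes "totally_dominated G S C = D"
    and f: "\<And>x C'. x \<in> V \<Longrightarrow> \<not> {x, \<sigma> x} \<subseteq> D \<Longrightarrow> totally_dominated G S C' = D \<union> {x, \<sigma> x} \<Longrightarrow>
      game_moves G S Dominator C' = f x"
    and upper: "\<And>x. x \<in> V \<Longrightarrow> \<not> {x, \<sigma> x} \<subseteq> D \<Longrightarrow> Suc (f x) \<le> m"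
    and lower: "y \<in> V" "\<not> {y, \<sigma> y} \<subseteq> D" "m \<le> Suc (f y)"
  shows "game_moves G S Staller C = m"
proof -
  have val: "game_moves G S Dominator (insert v C) = f x"
    if "v \<in> V" "x \<in> V" "neighbors G v = {x, \<sigma> x}" "\<not> {x, \<sigma> x} \<subseteq> D" for v x
    using that assms(1) by (intro f) (auto simp: totally_dominated_insert)
  obtain v where v: "v \<in> V" "neighbors G v = {y, \<sigma> y}"
    using neighborhood_ofE[OF lower(1)] by blast
  show ?thesis
  proof (rule game_moves_StallerI[OF finite_verts])
    fix w assume "w \<in> legal_moves G S C"
    then have w: "w \<in> V" "\<not> neighbors G w \<subseteq> D"
      using assms(1) by (simp_all add: legal_moves_iff)
    obtain x where x: "x \<in> V" "neighbors G w = {x, \<sigma> x}"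
      using neighborhoodE[OF w(1)] .
    then have "\<not> {x, \<sigma> x} \<subseteq> D" using w(2) by simp
    then show "Suc (game_moves G S Dominator (insert w C)) \<le> m"
      using val[OF w(1) x] upper[OF x(1)] by simp
  next
    show "v \<in> legal_moves G S C" using v lower(2) assms(1) by (simp add: legal_moves_iff)
    show "m \<le> Suc (game_moves G S Dominator (insert v C))" using val[OF v(1) lower(1) v(2) lower(2)] lower(3) by simp
  qed
qed

text \<open>Induction on the number of undominated vertices. Since no drop exceeds 3, no Dominator
  move beats \<open>weight D div 2\<close>, and \<open>weight_move_large\<close> attains it. Dually
  every drop is at least 1, and \<open>weight_move_small\<close> is optimal for Staller.\<close>

lemma game_value_all_covered:
  assumes "totally_dominated G S C = D" "V \<subseteq> covered D"
  shows "game_moves G S Dominator C = weight D div 2 \<and>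
    game_moves G S Staller C = (weight D + 1) div 2"
  using assms
proof (induction "card (V - D)" arbitrary: C D rule: less_induct)
  case less
  have DV: "D \<subseteq> V" using less.prems(1) unfolding totally_dominated_def by auto
  show ?case
  proof (cases "D = V")
    case True
    then have "legal_moves G S C = {}"
      using less.prems(1) unfolding legal_moves_iff set_eq_iff by (auto simp: neighbors_def)
    with True show ?thesis by (simp add: game_moves_no_legal weight_verts)
  next
    case False
    then obtain z where z: "z \<in> covered D" "z \<notin> D" using DV less.prems(2) by blast
    have IH: "game_moves G S Dominator C' = weight (D \<union> {x, \<sigma> x}) div 2 \<and>
        game_moves G S Staller C' = (weight (D \<union> {x, \<sigma> x}) + 1) div 2"
      if "x \<in> V" "\<not> {x, \<sigma> x} \<subseteq> D" "totally_dominated G S C' = D \<union> {x, \<sigma> x}" for x C'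
    proof (rule less.hyps[OF _ that(3)])
      show "card (V - (D \<union> {x, \<sigma> x})) < card (V - D)"
        using that step_in finite_verts by (intro psubset_card_mono) auto
      show "V \<subseteq> covered (D \<union> {x, \<sigma> x})"
        using covered_move less.prems(2) that(1) by blast
    qed
    note bounds = weight_move_bounds[OF DV subsetD[OF less.prems(2)]]
    have "game_moves G S Dominator C = weight D div 2"
    proof -
      obtain y where y: "y \<in> V" "\<not> {y, \<sigma> y} \<subseteq> D"
        "weight (D \<union> {y, \<sigma> y}) + 2 + weight D mod 2 \<le> weight D"
        using weight_move_large[OF DV z] by blast
      show ?thesis
      proof (rule game_value_Dominator[OF less.prems(1), where f = "\<lambda>x. (weight (D \<union> {x, \<sigma> x}) + 1) div 2"])
        show "weight D div 2 \<le> Suc ((weight (D \<union> {x, \<sigma> x}) + 1) div 2)"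
          if "x \<in> V" "\<not> {x, \<sigma> x} \<subseteq> D" for x
          using bounds[OF that] by linarith
        show "Suc ((weight (D \<union> {y, \<sigma> y}) + 1) div 2) \<le> weight D div 2"
          using y(3) div_mult_mod_eq[of "weight D" 2] by linarith
      qed (use IH y(1,2) in simp_all)
    qed
    moreover have "game_moves G S Staller C = (weight D + 1) div 2"
    proof -
      obtain y where y: "y \<in> V" "\<not> {y, \<sigma> y} \<subseteq> D"
        "weight D + weight D mod 2 \<le> weight (D \<union> {y, \<sigma> y}) + 2"
        using weight_move_small[OF DV z] by blast
      show ?thesis
      proof (rule game_value_Staller[OF less.prems(1), where f = "\<lambda>x. weight (D \<union> {x, \<sigma> x}) div 2"])
        show "Suc (weight (D \<union> {x, \<sigma> x}) div 2) \<le> (weight D + 1) div 2"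
          if "x \<in> V" "\<not> {x, \<sigma> x} \<subseteq> D" for x
          using bounds[OF that] by linarith
        have "(weight D + 1) div 2 * 2 = weight D + weight D mod 2" by presburger
        then show "(weight D + 1) div 2 \<le> Suc (weight (D \<union> {y, \<sigma> y}) div 2)"
          using y(3) by linarith
      qed (use IH y(1,2) in simp_all)
    qed
    ultimately show ?thesis ..
  qed
qed

section \<open>Positions with untouched orbits\<close>

definition is_orbit :: "nat \<Rightarrow> 'a set \<Rightarrow> bool" where
  "is_orbit m O' \<longleftrightarrow> O' \<noteq> {} \<and> O' \<subseteq> V \<and> (\<forall>x\<in>O'. range (\<lambda>i. (\<sigma> ^^ i) x) = O' \<and>
    (\<sigma> ^^ m) x = x \<and> (\<forall>i. 0 < i \<and> i < m \<longrightarrow> (\<sigma> ^^ i) x \<noteq> x))"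

text \<open>Going once round the orbit of \<open>y\<close> supplies an extra step, which can be
  cancelled even if \<open>\<sigma> x\<close> is \<open>y\<close> itself.\<close>

lemma covered_step_back:
  assumes "D \<subseteq> V" "x \<in> V" "\<sigma> x \<in> covered D"
  shows "x \<in> covered D"
proof -
  obtain t y where y: "y \<in> D" "\<sigma> x = (\<sigma> ^^ t) y" using assms(3) by (auto simp: covered_def)
  obtain r where r: "(\<sigma> ^^ Suc r) y = y" using iter_returns y(1) assms(1) by blast
  have "\<sigma> x = (\<sigma> ^^ (t + Suc r)) y"
    using y(2) r by (metis comp_apply funpow_add)
  then have "x = (\<sigma> ^^ (t + r)) y"
    using iter_diff[of x y 1 "t + Suc r"] assms(1,2) y(1) by auto
  then show ?thesis using iter_covered[OF y(1)] by simp
qed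

lemma iter_not_covered:
  assumes "D \<subseteq> V" "x \<in> V" "x \<notin> covered D"
  shows "(\<sigma> ^^ i) x \<notin> covered D"
  using assms by (induction i) (auto intro: iter_in dest: covered_step_back)

text \<open>The first dominated vertex of an untouched orbit starts a single gap that ends at the
  vertex itself. All older gaps lie in other orbits and stay as they are.\<close>

lemma weight_insert_uncovered:
  assumes "D \<subseteq> V" "x \<in> O'" "x \<notin> covered D" "is_orbit (Suc r) O'"
  shows "gap (insert x D) x = r" "weight (insert x D) = weight D + gap_weight r"
proof -
  have x: "x \<in> V" "(\<sigma> ^^ Suc r) x = x" "\<And>i. 0 < i \<Longrightarrow> i < Suc r \<Longrightarrow> (\<sigma> ^^ i) x \<noteq> x"
    using assms(2,4) unfolding is_orbit_def by auto
  have notD: "(\<sigma> ^^ i) x \<notin> D" for i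
    using iter_not_covered[OF assms(1) x(1) assms(3)] subset_covered by blast
  show g: "gap (insert x D) x = r"
    using x(2) x(3)[of "Suc _"] notD[of "Suc _"]
    by (intro gap_eqI) (auto simp del: funpow.simps)
  have "gap (insert x D) p = gap D p" if "p \<in> D" for p
  proof (rule gap_eqI)
    show "(\<sigma> ^^ Suc (gap D p)) p \<in> insert x D" using gap_end[OF assms(1) that] by blast
    show "(\<sigma> ^^ Suc i) p \<notin> insert x D" if "i < gap D p" for i
      using gap_interior[OF that] iter_covered[OF \<open>p \<in> D\<close>] assms(3) by (metis insertE)
  qed
  moreover have "finite D" "x \<notin> D"
    using assms(1) finite_verts finite_subset notD[of 0] by auto
  ultimately show "weight (insert x D) = weight D + gap_weight r"
    unfolding weight_def using g by simp
qed

lemma weight_open_orbit: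
  assumes "D \<subseteq> V" "x \<in> O'" "x \<notin> covered D" "is_orbit (Suc (Suc r)) O'"
  shows "weight (D \<union> {x, \<sigma> x}) = weight D + gap_weight r"
proof -
  note ins = weight_insert_uncovered[OF assms]
  have "insert x D \<subseteq> V" using assms(1,2,4) unfolding is_orbit_def by auto
  then have "weight (insert (\<sigma> x) (insert x D)) + gap_weight (Suc r) =
      weight (insert x D) + gap_weight r"
    using ins(1) by (intro weight_shorten) auto
  moreover have "insert (\<sigma> x) (insert x D) = D \<union> {x, \<sigma> x}" by blast
  ultimately show ?thesis using ins(2) by simp
qed

lemma covered_Un: "covered (A \<union> B) = covered A \<union> covered B"
  unfolding covered_def by blast

lemma covered_singleton: "covered {x} = range (\<lambda>i. (\<sigma> ^^ i) x)"
  unfolding covered_def by auto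

lemma covered_open_orbit:
  assumes "x \<in> O'" "is_orbit m O'"
  shows "covered (D \<union> {x, \<sigma> x}) = covered D \<union> O'"
proof -
  have "covered {x} = O'" using assms unfolding is_orbit_def covered_singleton by blast
  then show ?thesis
    using covered_move[of x "{x}"] assms(1) covered_Un[of D "{x, \<sigma> x}"] by (simp add: insert_commute)
qed

text \<open>A move in a touched orbit leads to the same situation with smaller weight. A move
  opening the last orbit leaves a new gap of length \<open>3 * k - 1\<close>, adds
  \<open>4 * k - 1\<close> to the weight, and leads to \<open>game_value_all_covered\<close>. Each
  player chooses between the two kinds according to the weight modulo 4.\<close>

lemma game_value_one_closed:
  assumes "totally_dominated G S C = D" "is_orbit (Suc (3 * k)) (V - covered D)" "k \<ge> 1"
  shows "game_moves G S Dominator C = 2 * k + 1 + 2 * (weight D div 4) \<and>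
    game_moves G S Staller C = 2 * k + 2 * ((weight D + 3) div 4)"
  using assms
proof (induction "card (V - D)" arbitrary: C D rule: less_induct)
  case less
  let ?W = "\<lambda>x. weight (D \<union> {x, \<sigma> x})"
  have DV: "D \<subseteq> V" using less.prems(1) unfolding totally_dominated_def by auto
  have "V - covered D \<noteq> {}" using less.prems(2) unfolding is_orbit_def by simp
  then obtain o1 where o1: "o1 \<in> V" "o1 \<notin> covered D" "\<not> {o1, \<sigma> o1} \<subseteq> D"
    using subset_covered[of D] by blast
  have W_open: "?W x = weight D + (4 * k - 1)" if "x \<in> V" "x \<notin> covered D" for x
  proof -
    obtain l where l: "k = Suc l" using less.prems(3) by (cases k) auto
    then have eq: "Suc (3 * k) = Suc (Suc (3 * l + 2))" by simp
    have "?W x = weight D + gap_weight (3 * l + 2)"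
      using weight_open_orbit[OF DV _ _ less.prems(2)[unfolded eq]] that by blast
    with l show ?thesis unfolding gap_weight_residues by simp
  qed
  \<comment> \<open>The value for Dominator is stated with \<open>Suc\<close> to keep subtraction
    out of the formula.\<close>
  have IH_open: "Suc (game_moves G S Dominator C') = 2 * k + (weight D + 1) div 2 \<and>
      game_moves G S Staller C' = 2 * k + weight D div 2"
    if "x \<in> V" "x \<notin> covered D" "totally_dominated G S C' = D \<union> {x, \<sigma> x}" for x C'
  proof -
    have "V \<subseteq> covered (D \<union> {x, \<sigma> x})"
      using covered_open_orbit[OF _ less.prems(2), of x D] that(1,2) by auto
    note * = game_value_all_covered[OF that(3) this, unfolded W_open[OF that(1,2)]]
    obtain l where l: "k = Suc l" using less.prems(3) by (cases k) auto
    have "weight D + (4 * k - 1) = weight D + 1 + (2 * l + 1) * 2"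
      "weight D + (4 * k - 1) + 1 = weight D + (2 * k) * 2" using l by simp_all
    then have "(weight D + (4 * k - 1)) div 2 = (weight D + 1) div 2 + (2 * l + 1)"
      "(weight D + (4 * k - 1) + 1) div 2 = weight D div 2 + 2 * k"
      by (simp_all only: div_mult_self1 zero_neq_numeral not_False_eq_True simp_thms)
    then show ?thesis using * l by linarith
  qed
  have IH: "game_moves G S Dominator C' = 2 * k + 1 + 2 * (?W x div 4) \<and>
      game_moves G S Staller C' = 2 * k + 2 * ((?W x + 3) div 4)"
    if "x \<in> V" "x \<in> covered D" "\<not> {x, \<sigma> x} \<subseteq> D" "totally_dominated G S C' = D \<union> {x, \<sigma> x}" for x C'
  proof (rule less.hyps[OF _ that(4)])
    show "card (V - (D \<union> {x, \<sigma> x})) < card (V - D)"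
      using that step_in finite_verts by (intro psubset_card_mono) auto
    show "is_orbit (Suc (3 * k)) (V - covered (D \<union> {x, \<sigma> x}))"
      using covered_move less.prems(2) that(2) by simp
  qed (fact less.prems(3))
  note bounds = weight_move_bounds[OF DV]
  have uncovered_exists: "\<exists>z. z \<in> covered D \<and> z \<notin> D" if "weight D \<noteq> 0"
  proof (rule ccontr)
    assume *: "\<not> ?thesis"
    have "gap D p = 0" if "p \<in> D" for p
      using * iter_covered[OF that, of 1] by (intro gap_eqI) auto
    then have "weight D = 0" unfolding weight_def by simp
    with that show False by simp
  qed
  have "game_moves G S Dominator C = 2 * k + 1 + 2 * (weight D div 4)"
  proof -
    define f where "f x = (if x \<in> covered D then 2 * k + 2 * ((?W x + 3) div 4)
      else 2 * k + weight D div 2)" for x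
    have "\<exists>y\<in>V. \<not> {y, \<sigma> y} \<subseteq> D \<and> Suc (f y) \<le> 2 * k + 1 + 2 * (weight D div 4)"
    \<comment> \<open>The equation says that the weight is 0 or 1 modulo 4; then opening the
      untouched orbit is optimal. Otherwise the weight is positive and a large drop in a touched
      orbit is played.\<close>
    proof (cases "weight D div 2 = 2 * (weight D div 4)")
      case True
      then show ?thesis using o1 unfolding f_def by auto
    next
      case False
      have "weight D \<noteq> 0" by (rule notI) (use False in simp)
      then obtain z where "z \<in> covered D" "z \<notin> D" using uncovered_exists by blast
      then obtain y where y: "y \<in> covered D" "y \<in> V" "\<not> {y, \<sigma> y} \<subseteq> D"
        "?W y + 2 + weight D mod 2 \<le> weight D"
        using weight_move_large[OF DV] by blast
      have "(?W y + 3) div 4 \<le> weight D div 4" using y(4) by (rule div_4_le_of_even_bound)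
      then show ?thesis using y(1-3) unfolding f_def by auto
    qed
    then obtain y where y: "y \<in> V" "\<not> {y, \<sigma> y} \<subseteq> D"
      "Suc (f y) \<le> 2 * k + 1 + 2 * (weight D div 4)" by blast
    show ?thesis
    proof (rule game_value_Dominator[where f = f, OF less.prems(1) _ _ y])
      fix x assume x: "x \<in> V" "\<not> {x, \<sigma> x} \<subseteq> D"
      show "2 * k + 1 + 2 * (weight D div 4) \<le> Suc (f x)"
      proof (cases "x \<in> covered D")
        case True
        have "weight D div 4 \<le> (?W x + 3) div 4" using bounds[OF True x(2)] by linarith
        with True show ?thesis unfolding f_def by simp
      next
        case False
        have "2 * (weight D div 4) \<le> weight D div 2" by linarith
        with False show ?thesis unfolding f_def by simp
      qed
      show "game_moves G S Staller C' = f x" if "totally_dominated G S C' = D \<union> {x, \<sigma> x}" for C'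
        using IH[OF x(1) _ x(2) that] IH_open[OF x(1) _ that] unfolding f_def by simp
    qed
  qed
  moreover have "game_moves G S Staller C = 2 * k + 2 * ((weight D + 3) div 4)"
  proof -
    \<comment> \<open>The subtraction in the second branch is exact because
      \<open>k \<ge> 1\<close>.\<close>
    define f where "f x = (if x \<in> covered D then 2 * k + 1 + 2 * (?W x div 4)
      else 2 * k + (weight D + 1) div 2 - 1)" for x
    have "\<exists>y\<in>V. \<not> {y, \<sigma> y} \<subseteq> D \<and> 2 * k + 2 * ((weight D + 3) div 4) \<le> Suc (f y)"
    \<comment> \<open>Staller opens the untouched orbit when the weight is 0 or 3 modulo 4, and
      otherwise plays a small drop in a touched orbit.\<close>
    proof (cases "(weight D + 1) div 2 = 2 * ((weight D + 3) div 4)")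
      case True
      then have "2 * k + 2 * ((weight D + 3) div 4) \<le> Suc (f o1)"
        using o1(2) unfolding f_def by simp
      then show ?thesis using o1 by blast
    next
      case False
      have "weight D \<noteq> 0" by (rule notI) (use False in simp)
      then obtain z where "z \<in> covered D" "z \<notin> D" using uncovered_exists by blast
      then obtain y where y: "y \<in> covered D" "y \<in> V" "\<not> {y, \<sigma> y} \<subseteq> D"
        "weight D + weight D mod 2 \<le> ?W y + 2"
        using weight_move_small[OF DV] by blast
      have "(weight D + 3) div 4 \<le> ?W y div 4 + 1" using y(4) by (rule ceiling_div_4_le_of_even_bound)
      then show ?thesis using y(1-3) unfolding f_def by auto
    qed
    then obtain y where y: "y \<in> V" "\<not> {y, \<sigma> y} \<subseteq> D"
      "2 * k + 2 * ((weight D + 3) div 4) \<le> Suc (f y)" by blast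
    show ?thesis
    proof (rule game_value_Staller[where f = f, OF less.prems(1) _ _ y])
      fix x assume x: "x \<in> V" "\<not> {x, \<sigma> x} \<subseteq> D"
      show "Suc (f x) \<le> 2 * k + 2 * ((weight D + 3) div 4)"
      proof (cases "x \<in> covered D")
        case True
        have "?W x div 4 + 1 \<le> (weight D + 3) div 4" using bounds[OF True x(2)] by linarith
        with True show ?thesis unfolding f_def by simp
      next
        case False
        have "(weight D + 1) div 2 \<le> 2 * ((weight D + 3) div 4)" by linarith
        with False show ?thesis using less.prems(3) unfolding f_def by simp
      qed
      show "game_moves G S Dominator C' = f x" if "totally_dominated G S C' = D \<union> {x, \<sigma> x}" for C'
        using IH[OF x(1) _ x(2) that] IH_open[OF x(1) _ that] unfolding f_def by fastforce
    qed
  qed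
  ultimately show ?case ..
qed

text \<open>All first moves are equally good: each opens one orbit, leaving weight
  \<open>4 * k - 1\<close> there and the other orbit untouched, so that \<open>4 * k\<close> further
  moves follow.\<close>

lemma game_value_two_closed:
  assumes "totally_dominated G S C = {}" "V \<noteq> {}" "k \<ge> 1"
    and orbits: "\<And>x. x \<in> V \<Longrightarrow> is_orbit (Suc (3 * k)) (covered {x})"
      "\<And>x. x \<in> V \<Longrightarrow> is_orbit (Suc (3 * k)) (V - covered {x})"
  shows "game_moves G S Dominator C = 4 * k + 1"
proof -
  obtain y where "y \<in> V" using assms(2) by blast
  have "game_moves G S Staller C' = 4 * k"
    if x: "x \<in> V" and C': "totally_dominated G S C' = {} \<union> {x, \<sigma> x}" for x C'
  proof -
    have "x \<in> covered {x}" using subset_covered by blast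
    obtain l where l: "k = Suc l" using assms(3) by (cases k) auto
    then have eq: "Suc (3 * k) = Suc (Suc (3 * l + 2))" by simp
    have W: "weight ({} \<union> {x, \<sigma> x}) = 4 * l + 3"
      using weight_open_orbit[OF _ \<open>x \<in> covered {x}\<close> _ orbits(1)[OF x, unfolded eq], of "{}"]
      by (simp add: gap_weight_residues(3)[simplified])
    have "covered ({} \<union> {x, \<sigma> x}) = covered {x}"
      using covered_move[OF \<open>x \<in> covered {x}\<close>] by (simp add: insert_commute)
    then have "game_moves G S Staller C' = 2 * k + 2 * ((4 * l + 3 + 3) div 4)"
      using game_value_one_closed[OF C'] orbits(2)[OF x] assms(3) unfolding W by simp
    moreover have "(4 * l + 3 + 3) div 4 = l + 1" by simp
    ultimately show ?thesis using l by simp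
  qed
  then show ?thesis
    using \<open>y \<in> V\<close> by (intro game_value_Dominator[OF assms(1), where f = "\<lambda>_. 4 * k" and y = y]) auto
qed

end

section \<open>Cycles as instances, and the two parity orbits of an even cycle\<close>

definition two_steps :: "nat \<Rightarrow> nat \<Rightarrow> nat" where
  "two_steps n x = (x + 2) mod n"

lemma mod_wrap: "a mod n = (if a < n then a else a - n)" if "a < 2 * n" for a n :: nat
  using that by (simp add: le_mod_geq)

lemma neighbors_cycle_graph:
  assumes "n \<ge> 3" "v < n"
  shows "neighbors (cycle_graph n) v = {(v + n - 1) mod n, (v + 1) mod n}"
proof -
  have "(v + n - 1) mod n = (if v = 0 then n - 1 else v - 1)"
    using assms mod_wrap[of "v + n - 1" n] by auto
  moreover have "Suc i mod n = (if Suc i = n then 0 else Suc i)" if "i < n" for i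
    using that by simp
  ultimately have "Suc i mod n = v \<and> i < n \<longleftrightarrow> i = (v + n - 1) mod n" for i
    using assms by (cases "i < n") auto
  moreover have "neighbors (cycle_graph n) v = {w. w = Suc v mod n \<or> (Suc w mod n = v \<and> w < n)}"
    unfolding neighbors_def cycle_graph_def using assms
    by (auto simp: doubleton_eq_iff)
  ultimately show ?thesis by auto
qed

text \<open>The neighborhood of \<open>v\<close> is the pair starting at the predecessor of
  \<open>v\<close>; conversely the pair starting at \<open>x\<close> is the neighborhood of the
  successor of \<open>x\<close>.\<close>

lemma perm_graph_cycle_graph:
  assumes "n \<ge> 3"
  shows "perm_graph (cycle_graph n) (two_steps n)"
proof
  show "finite (verts (cycle_graph n))" by (simp add: cycle_graph_def)
  show "bij_betw (two_steps n) (verts (cycle_graph n)) (verts (cycle_graph n))"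
    using assms
    by (intro bij_betw_byWitness[where f' = "\<lambda>x. (x + n - 2) mod n"])
      (auto simp: cycle_graph_def two_steps_def mod_wrap)
  have nb: "neighbors (cycle_graph n) v = {(v + n - 1) mod n, two_steps n ((v + n - 1) mod n)}"
    if "v < n" for v
    using assms that unfolding neighbors_cycle_graph[OF assms that] by (auto simp: two_steps_def mod_wrap)
  have pred: "((x + 1) mod n + n - 1) mod n = x" if "x < n" for x
    using assms that by (auto simp: mod_wrap)
  show "neighbors (cycle_graph n) ` verts (cycle_graph n) =
      (\<lambda>x. {x, two_steps n x}) ` verts (cycle_graph n)"
  proof (intro equalityI image_subsetI)
    fix v assume "v \<in> verts (cycle_graph n)"
    then show "neighbors (cycle_graph n) v \<in> (\<lambda>x. {x, two_steps n x}) ` verts (cycle_graph n)"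
      using nb[of v] by (auto simp: cycle_graph_def)
  next
    fix x assume "x \<in> verts (cycle_graph n)"
    then have "x < n" by (simp add: cycle_graph_def)
    then have "{x, two_steps n x} = neighbors (cycle_graph n) ((x + 1) mod n)"
      using nb[of "(x + 1) mod n"] pred[of x] by simp
    moreover have "(x + 1) mod n \<in> verts (cycle_graph n)"
      using \<open>x < n\<close> by (simp add: cycle_graph_def)
    ultimately show "{x, two_steps n x} \<in> neighbors (cycle_graph n) ` verts (cycle_graph n)"
      by blast
  qed
qed

locale even_cycle =
  fixes m n :: nat
  assumes n: "n = 2 * m" and m: "m \<ge> 2"
begin

sublocale perm_graph "cycle_graph n" "two_steps n"
  using n m by (intro perm_graph_cycle_graph) simp

lemma V_eq: "V = {0..<n}"
  by (simp add: cycle_graph_def)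

lemma iter_eq: "x < n \<Longrightarrow> (two_steps n ^^ i) x = (x + 2 * i) mod n"
  by (induction i) (auto simp: two_steps_def mod_simps)

lemma covered_parity:
  assumes "u < n"
  shows "covered {u} = {y. y < n \<and> y mod 2 = u mod 2}"
proof (intro equalityI subsetI)
  fix y assume "y \<in> covered {u}"
  then obtain i where "y = (u + 2 * i) mod n"
    using iter_eq[OF assms] unfolding covered_singleton by auto
  moreover have "(u + 2 * i) mod n mod 2 = (u + 2 * i) mod 2"
    using n by (simp add: mod_mod_cancel)
  ultimately show "y \<in> {y. y < n \<and> y mod 2 = u mod 2}" using n m by auto
next
  fix y assume y: "y \<in> {y. y < n \<and> y mod 2 = u mod 2}"
  have "y mod 2 = u mod 2" using y by simp
  then have "even y \<longleftrightarrow> even u" by presburger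
  moreover have "even ((y + n - u) + u) \<longleftrightarrow> even (y + n)" using assms by simp
  moreover have "even n" using n by simp
  ultimately have "even (y + n - u)" unfolding even_add by blast
  \<comment> \<open>Half of \<open>y + n - u\<close> is the number of double steps from
    \<open>u\<close> to \<open>y\<close>; adding \<open>n\<close> first keeps the difference
    nonnegative, and evenness makes the halving exact.\<close>
  then have "u + 2 * ((y + n - u) div 2) = y + n" using assms by simp
  then have "(two_steps n ^^ ((y + n - u) div 2)) u = y"
    using y by (simp add: iter_eq[OF assms])
  then show "y \<in> covered {u}" unfolding covered_singleton by (metis rangeI)
qed

lemma is_orbit_covered:
  assumes "u < n"
  shows "is_orbit m (covered {u})"
  unfolding is_orbit_def
proof (intro conjI ballI allI impI)
  show "covered {u} \<noteq> {}" "covered {u} \<subseteq> V"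
    using assms by (auto simp: covered_parity V_eq)
  fix x assume "x \<in> covered {u}"
  then have x: "x < n" "x mod 2 = u mod 2" using assms by (auto simp: covered_parity)
  then show "range (\<lambda>i. (two_steps n ^^ i) x) = covered {u}"
    using assms by (simp add: covered_parity flip: covered_singleton)
  show "(two_steps n ^^ m) x = x" using x by (simp add: iter_eq flip: n)
  fix i assume i: "0 < i \<and> i < m"
  then have "x + 2 * i < 2 * n" using x n by simp
  then have "(x + 2 * i) mod n \<noteq> x" using x(1) i n by (simp only: mod_wrap) (auto split: if_splits)
  then show "(two_steps n ^^ i) x \<noteq> x" using x(1) by (simp add: iter_eq)
qed

text \<open>The complement is the other parity class, represented by whichever of 0 and 1 has that
  parity.\<close>

lemma covered_complement:
  assumes "u < n"
  shows "V - covered {u} = covered {1 - u mod 2}"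
proof -
  have "1 - u mod 2 < n" using n m by simp
  then have "covered {1 - u mod 2} = {y. y < n \<and> y mod 2 = (1 - u mod 2) mod 2}"
    by (rule covered_parity)
  also have "\<dots> = {y. y < n \<and> y mod 2 \<noteq> u mod 2}"
    by (cases "u mod 2 = 0") (auto simp: mod2_eq_if)
  also have "\<dots> = V - covered {u}" unfolding covered_parity[OF assms] V_eq by auto
  finally show ?thesis by (rule sym)
qed

lemma is_orbit_complement:
  assumes "u < n"
  shows "is_orbit m (V - covered {u})"
  unfolding covered_complement[OF assms] by (rule is_orbit_covered) (use n m in simp)

end

section \<open>Values on the cycle with zero or two predominated vertices\<close>

lemma total_dom_game_number_cycle:
  assumes "k \<ge> 1" "n = 6 * k + 2"
  shows "total_dom_game_number (cycle_graph n) {} = 4 * k + 1"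
proof -
  interpret even_cycle "Suc (3 * k)" n using assms by unfold_locales auto
  have "totally_dominated (cycle_graph n) {} {} = {}"
    by (simp add: totally_dominated_def)
  moreover have "V \<noteq> {}" using assms(2) unfolding V_eq by simp
  ultimately show ?thesis
    unfolding total_dom_game_number_def
    using game_value_two_closed[OF _ _ assms(1)] is_orbit_covered is_orbit_complement
    by (metis V_eq atLeastLessThan_iff)
qed

text \<open>For odd \<open>d\<close> the two vertices lie in different orbits, each left with one
  gap of length \<open>3 * k\<close>, so the weight is \<open>8 * k\<close>. For
  \<open>d = 2 * e\<close> they share an orbit, where \<open>v\<close> is the \<open>e\<close>-th
  iterate of \<open>u\<close> and cuts the gap \<open>3 * k\<close> into \<open>e - 1\<close> and
  \<open>3 * k - e\<close>, while the other orbit is untouched.\<close>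

lemma total_dom_game_number_cycle_pair:
  assumes "k \<ge> 1" "n = 6 * k + 2" "u < n" "0 < d" "d < n" "v = (u + d) mod n"
  shows "odd d \<Longrightarrow> total_dom_game_number (cycle_graph n) {u, v} = 4 * k"
    and "d = 2 * e \<Longrightarrow> total_dom_game_number (cycle_graph n) {u, v} =
      2 * k + 1 + 2 * ((gap_weight (e - 1) + gap_weight (3 * k - e)) div 4)"
proof -
  interpret even_cycle "Suc (3 * k)" n using assms(1,2) by unfold_locales auto
  have v: "v < n" using assms(2,6) by simp
  have uV: "{u} \<subseteq> V" using assms(3) by (simp add: V_eq)
  have td: "totally_dominated (cycle_graph n) {u, v} {} = {u, v}"
    using assms(3) v by (auto simp: totally_dominated_def V_eq)
  have "u \<in> covered {u}" using subset_covered by blast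
  then have gap_u: "gap {u} u = 3 * k" and weight_u: "weight {u} = gap_weight (3 * k)"
    using weight_insert_uncovered[OF _ _ _ is_orbit_covered[OF assms(3)], of "{}" u] by simp_all
  have cov: "covered {u, v} = covered {u} \<union> covered {v}"
    using covered_Un[of "{u}" "{v}"] by (simp add: insert_commute)
  have v_mod: "v mod 2 = (u + d) mod 2"
    unfolding assms(6) by (rule mod_mod_cancel) (simp add: assms(2))
  {
    assume "odd d"
    then have "v mod 2 \<noteq> u mod 2" using v_mod by presburger
    then have "v \<notin> covered {u}" "V \<subseteq> covered {u, v}"
      using assms(3) v unfolding cov by (auto simp: covered_parity V_eq)
    moreover have "v \<in> covered {v}" using subset_covered by blast
    ultimately have "weight (insert v {u}) = 8 * k" "V \<subseteq> covered {u, v}"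
      using weight_insert_uncovered(2)[OF uV _ _ is_orbit_covered[OF v]] weight_u
      by (simp_all add: gap_weight_residues)
    moreover have "insert v {u} = {u, v}" by blast
    ultimately have "weight {u, v} = 8 * k" "V \<subseteq> covered {u, v}" by simp_all
    then show "total_dom_game_number (cycle_graph n) {u, v} = 4 * k"
      unfolding total_dom_game_number_def using game_value_all_covered[OF td] by simp
  }
  {
    assume e: "d = 2 * e"
    then have par: "v mod 2 = u mod 2" using v_mod by simp
    have "Suc (e - 1) = e" "e - 1 < gap {u} u" using e assms(2,4,5) gap_u by auto
    then have "weight {u, v} + gap_weight (3 * k) =
        weight {u} + gap_weight (e - 1) + gap_weight (3 * k - e)"
      using weight_insert(2)[OF uV, of u "e - 1" v] iter_eq[OF assms(3), of e] gap_u assms(6) e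
      by (simp del: funpow.simps add: insert_commute)
    then have "weight {u, v} = gap_weight (e - 1) + gap_weight (3 * k - e)"
      using weight_u by simp
    moreover have "covered {u, v} = covered {u}"
      using par assms(3) v unfolding cov by (simp add: covered_parity)
    ultimately show "total_dom_game_number (cycle_graph n) {u, v} =
        2 * k + 1 + 2 * ((gap_weight (e - 1) + gap_weight (3 * k - e)) div 4)"
      unfolding total_dom_game_number_def
      using game_value_one_closed[OF td] is_orbit_complement[OF assms(3)] assms(1) by simp
  }
qed

section \<open>Distance in the cycle\<close>

lemma cycle_graph_edge:
  assumes "{a, b} \<in> edges (cycle_graph n)"
  shows "b = (a + 1) mod n \<or> a = (b + 1) mod n"
  using assms by (auto simp: cycle_graph_def doubleton_eq_iff)

text \<open>Lifting to the integers: each edge contributes 1 or -1 modulo \<open>n\<close>, so the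
  total displacement is bounded by the number of edges.\<close>

lemma cycle_walk_displacement:
  assumes "is_walk (cycle_graph n) p" "length p = Suc k"
  shows "\<exists>z. \<bar>z\<bar> \<le> int k \<and> (int (hd p) + z) mod int n = int (last p) mod int n"
  using assms
proof (induction p arbitrary: k)
  case Nil
  then show ?case by simp
next
  case (Cons a p)
  show ?case
  proof (cases p)
    case Nil
    then show ?thesis by (intro exI[of _ 0]) simp
  next
    case (Cons b q)
    have "is_walk (cycle_graph n) p"
      using Cons.prems(1) Cons unfolding is_walk_def by fastforce
    moreover obtain l where l: "k = Suc l" "length p = Suc l"
      using Cons.prems(2) Cons by auto
    ultimately obtain z where z: "\<bar>z\<bar> \<le> int l" "(int b + z) mod int n = int (last p) mod int n"
      using Cons.IH Cons by fastforce
    have "{a, b} \<in> edges (cycle_graph n)"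
      using Cons.prems(1) Cons unfolding is_walk_def by fastforce
    then consider "b = (a + 1) mod n" | "a = (b + 1) mod n"
      using cycle_graph_edge by blast
    then obtain s where s: "\<bar>s\<bar> \<le> 1" "(int a + s) mod int n = int b mod int n"
    proof cases
      case 1
      show ?thesis by (rule that[of 1]) (simp_all add: 1 of_nat_mod add.commute)
    next
      case 2
      show ?thesis by (rule that[of "-1"]) (simp_all add: 2 of_nat_mod mod_simps)
    qed
    have "(int a + (s + z)) mod int n = ((int a + s) mod int n + z) mod int n"
      by (simp add: mod_simps add.assoc)
    also have "\<dots> = int (last p) mod int n"
      unfolding s(2) using z(2) by (simp add: mod_simps)
    finally show ?thesis
      using s(1) z(1) l Cons by (intro exI[of _ "s + z"]) auto
  qed
qed

lemma cycle_walk_up: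
  assumes "n > 0" "u < n"
  shows "\<exists>p. is_walk (cycle_graph n) p \<and> hd p = u \<and> last p = (u + e) mod n \<and> length p = Suc e"
proof (intro exI conjI)
  let ?p = "map (\<lambda>i. (u + i) mod n) [0..<Suc e]"
  show "is_walk (cycle_graph n) ?p"
    unfolding is_walk_def
  proof (intro conjI allI impI)
    show "set ?p \<subseteq> verts (cycle_graph n)" using assms by (auto simp: cycle_graph_def)
    fix i assume "Suc i < length ?p"
    then have "?p ! i = (u + i) mod n" "?p ! Suc i = Suc ((u + i) mod n) mod n"
      by (simp_all del: upt_Suc add: mod_simps)
    then show "{?p ! i, ?p ! Suc i} \<in> edges (cycle_graph n)"
      using assms by (auto simp: cycle_graph_def)
  qed simp
  show "hd ?p = u" using assms by (simp add: hd_map del: upt_Suc)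
  show "last ?p = (u + e) mod n" by simp
  show "length ?p = Suc e" by simp
qed

lemma is_walk_rev:
  assumes "is_walk G p"
  shows "is_walk G (rev p)"
  unfolding is_walk_def
proof (intro conjI allI impI)
  show "rev p \<noteq> []" "set (rev p) \<subseteq> verts G" using assms by (auto simp: is_walk_def)
  fix i assume i: "Suc i < length (rev p)"
  define j where "j = length p - Suc (Suc i)"
  have "Suc j < length p" "rev p ! i = p ! Suc j" "rev p ! Suc i = p ! j"
    using i by (auto simp: rev_nth j_def Suc_diff_Suc)
  then show "{rev p ! i, rev p ! Suc i} \<in> edges G"
    using assms unfolding is_walk_def by (metis insert_commute)
qed

text \<open>Here \<open>a\<close> and \<open>b\<close> are the lengths of the two arcs. Walking
  along either arc bounds \<open>d\<close> from above. The displacement of a shortest walk is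
  smaller than \<open>n\<close> in absolute value and congruent to \<open>a\<close> and to
  \<open>-b\<close>, so its sign decides which arc has length \<open>d\<close>.\<close>

lemma graph_dist_cycle:
  assumes "n > 0" "u < n" "v < n"
  defines "d \<equiv> graph_dist (cycle_graph n) u v"
  shows "d < n \<and> (v = (u + d) mod n \<or> u = (v + d) mod n)"
proof -
  let ?P = "\<lambda>k. \<exists>p. is_walk (cycle_graph n) p \<and> hd p = u \<and> last p = v \<and> length p = Suc k"
  define a where "a = (v + n - u) mod n"
  define b where "b = (u + n - v) mod n"
  have va: "v = (u + a) mod n" and ub: "u = (v + b) mod n"
    using assms(1-3) unfolding a_def b_def by (simp_all add: mod_simps)
  have "?P a" using cycle_walk_up[OF assms(1,2), of a] va by simp
  then have da: "d \<le> a" and Pd: "?P d"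
    unfolding d_def graph_dist_def by (rule Least_le, rule LeastI)
  obtain q where q: "is_walk (cycle_graph n) q" "hd q = v" "last q = u" "length q = Suc b"
    using cycle_walk_up[OF assms(1,3), of b] ub by auto
  then have "q \<noteq> []" by auto
  with q have "?P b" by (intro exI[of _ "rev q"]) (auto simp: is_walk_rev hd_rev last_rev)
  then have db: "d \<le> b" unfolding d_def graph_dist_def by (rule Least_le)
  obtain z where z: "\<bar>z\<bar> \<le> int d" "(int u + z) mod int n = int v mod int n"
    using Pd cycle_walk_displacement by blast
  have "a < n" using assms(1) unfolding a_def by simp
  have "b < n" using assms(1) unfolding b_def by simp
  have va': "int v mod int n = (int u + int a) mod int n"
    and ub': "int u mod int n = (int v + int b) mod int n"
    using va ub by (metis mod_mod_trivial of_nat_add of_nat_mod)+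
  have "d = a \<or> d = b"
  proof (cases "z \<ge> 0")
    case True
    have "z mod int n = int a mod int n"
      using mod_diff_cong[OF trans[OF z(2) va'] refl, of "int u"] by simp
    moreover have "z < int n" using z(1) da \<open>a < n\<close> by linarith
    ultimately have "z = int a" using True \<open>a < n\<close> by simp
    then show ?thesis using z(1) da by linarith
  next
    case False
    have "(- z) mod int n = int b mod int n"
      using mod_diff_cong[OF ub' z(2)] by simp
    moreover have "- z < int n" using z(1) da \<open>a < n\<close> by linarith
    ultimately have "- z = int b" using False \<open>b < n\<close> by simp
    then show ?thesis using z(1) db by linarith
  qed
  then show ?thesis using va ub da \<open>a < n\<close> by auto
qed

theorem theorem3p1:
  fixes n u1 u2 d :: nat
  assumes "n mod 6 = 2" and "n \<ge> 8"
    and "u1 \<in> verts (cycle_graph n)" and "u2 \<in> verts (cycle_graph n)" and "u1 \<noteq> u2"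
    and "d = graph_dist (cycle_graph n) u1 u2"
  shows "(d mod 6 = 4 \<longrightarrow>
            int (total_dom_game_number (cycle_graph n) {u1, u2})
              = int (total_dom_game_number (cycle_graph n) {})) \<and>
         (d mod 6 \<in> {1, 3, 5} \<longrightarrow>
            int (total_dom_game_number (cycle_graph n) {u1, u2})
              = int (total_dom_game_number (cycle_graph n) {}) - 1) \<and>
         (d mod 6 \<in> {0, 2} \<longrightarrow>
            int (total_dom_game_number (cycle_graph n) {u1, u2})
              = int (total_dom_game_number (cycle_graph n) {}) - 2)"
proof -
  define k where "k = n div 6"
  have n: "n = 6 * k + 2" and k: "k \<ge> 1"
    using assms(1,2) unfolding k_def by presburger+
  have "u1 < n" "u2 < n" using assms(3,4) by (auto simp: cycle_graph_def)
  then have d: "d < n" "u2 = (u1 + d) mod n \<or> u1 = (u2 + d) mod n"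
    using graph_dist_cycle[of n u1 u2] assms(2,6) by auto
  have "d > 0" using d(2) assms(5) \<open>u1 < n\<close> \<open>u2 < n\<close> by (cases d) auto
  \<comment> \<open>The distance does not tell which vertex is \<open>d\<close> steps ahead, so the
    pair is renamed accordingly.\<close>
  obtain u v where uv: "u < n" "v = (u + d) mod n" "{u1, u2} = {u, v}"
    using d(2)
  proof
    assume "u2 = (u1 + d) mod n"
    then show ?thesis using that[of u1 u2] \<open>u1 < n\<close> by simp
  next
    assume "u1 = (u2 + d) mod n"
    then show ?thesis using that[of u2 u1] \<open>u2 < n\<close> by (simp add: insert_commute)
  qed
  note val = total_dom_game_number_cycle_pair[OF k n uv(1) \<open>d > 0\<close> d(1) uv(2)]
  have base: "total_dom_game_number (cycle_graph n) {} = 4 * k + 1"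
    by (rule total_dom_game_number_cycle[OF k n])
  have even_val: "total_dom_game_number (cycle_graph n) {u1, u2} =
      2 * k + 1 + 2 * ((gap_weight (e - 1) + gap_weight (3 * k - e)) div 4)" if "d = 2 * e" for e
    using val(2)[OF that] uv(3) n by simp
  \<comment> \<open>For even \<open>d\<close> the residue of \<open>d div 2\<close> modulo 3
    decides. The form \<open>3 * a + 3\<close> for residue 0 reflects that \<open>d\<close> is
    positive.\<close>
  consider "odd d" | a where "d = 2 * (3 * a + 2)" | a where "d = 2 * (3 * a + 1)"
    | a where "d = 2 * (3 * a + 3)"
  proof (cases "odd d")
    case False
    then obtain e where e: "d = 2 * e" by blast
    obtain f where f: "e = Suc f" using e \<open>d > 0\<close> by (cases e) auto
    have "f = 3 * (f div 3) + f mod 3" by simp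
    moreover have "f mod 3 = 0 \<or> f mod 3 = 1 \<or> f mod 3 = 2" by presburger
    ultimately consider "e = 3 * (f div 3) + 1" | "e = 3 * (f div 3) + 2" | "e = 3 * (f div 3) + 3"
      using f by linarith
    then show ?thesis using that(2-4) e by cases blast+
  qed (use that(1) in blast)
  then show ?thesis
  proof cases
    case 1
    then have "d mod 6 \<in> {1, 3, 5}" by auto presburger
    then show ?thesis using val(1)[OF 1] base uv(3) n by auto
  next
    case 2
    \<comment> \<open>In each even case \<open>b\<close> plays for the second gap the role of
      \<open>a\<close> for the first; \<open>d < n\<close> ensures \<open>a < k\<close>, so nothing
      is truncated. Here the weight is \<open>4 * k\<close>; in the other two cases it is
      \<open>4 * k - 1\<close>, which lowers the quotient by 4 by one and the value by 2.\<close>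
    define b where "b = k - 1 - a"
    have "3 * a + 2 - 1 = 3 * a + 1" "3 * k - (3 * a + 2) = 3 * b + 1" "k = a + b + 1"
      using 2 d(1) n unfolding b_def by auto
    then have "total_dom_game_number (cycle_graph n) {u1, u2} = 4 * k + 1"
      unfolding even_val[OF 2] by (simp only: gap_weight_residues) simp
    moreover have "d mod 6 = 4" using 2 by presburger
    ultimately show ?thesis using base by simp
  next
    case 3
    define b where "b = k - 1 - a"
    have "3 * a + 1 - 1 = 3 * a" "3 * k - (3 * a + 1) = 3 * b + 2" "k = a + b + 1"
      using 3 d(1) n unfolding b_def by auto
    then have "total_dom_game_number (cycle_graph n) {u1, u2} = 4 * k - 1"
      unfolding even_val[OF 3] by (simp only: gap_weight_residues) simp
    moreover have "d mod 6 = 2" using 3 by presburger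
    ultimately show ?thesis using base k by simp
  next
    case 4
    define b where "b = k - 1 - a"
    have "3 * a + 3 - 1 = 3 * a + 2" "3 * k - (3 * a + 3) = 3 * b" "k = a + b + 1"
      using 4 d(1) n unfolding b_def by auto
    then have "total_dom_game_number (cycle_graph n) {u1, u2} = 4 * k - 1"
      unfolding even_val[OF 4] by (simp only: gap_weight_residues) simp
    moreover have "d mod 6 = 0" using 4 by presburger
    ultimately show ?thesis using base k by simp
  qed
qed

end
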